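(* Let $C_n$ be the cycle of order $n\ge 3$ and $\mu(C_n)$ its Mycielskian graph. Then $\gamma_p(\mu(C_n))=1$ if $n=3$, and $\gamma_p(\mu(C_n))=2$ if $n\ge 4$.
   Context: All graphs are finite, simple and undirected. $N[v]$ denotes the closed neighborhood of $v$ and $N[S]=\bigcup_{v\in S}N[v]$. For $U\subseteq V(G)$, the closure $cl(U)$ is the set obtained from $U$ by repeatedly applying, until no more changes are possible, the rule: if a vertex $u$ is in the current set and exactly one neighbor $w$ of $u$ is not in it, then add $w$. A set $S\subseteq V(G)$ is a power dominating set of $G$ if $cl(N[S])=V(G)$, and the power domination number $\gamma_p(G)$ is the minimum cardinality of a power dominating set. For a graph $G$ with vertex set $V=\{v_1,\dots,v_n\}$, the Mycielskian graph $\mu(G)$ has vertex set $V\cup\{u_1,\dots,u_n\}\cup\{w\}$ (all these vertices distinct) and edge set $E(G)\cup\{u_iv_j : v_iv_j\in E(G)\}\cup\{u_iw : 1\le i\le n\}$. *)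

theory Defs
  imports "Graph_Theory.Pair_Digraph"
begin

text \<open>
  A finite simple undirected graph is a \<^locale>\<open>pair_graph\<close>: a finite, symmetric, loop-free
  set of ordered pairs, so that each edge is represented by its two orientations.
\<close>

definition nbhd :: "'a pair_pre_digraph \<Rightarrow> 'a \<Rightarrow> 'a set" where
  "nbhd G v = parcs G `` {v}"

definition closed_nbhd :: "'a pair_pre_digraph \<Rightarrow> 'a \<Rightarrow> 'a set" where
  "closed_nbhd G v = insert v (nbhd G v)"

definition closed_nbhd_set :: "'a pair_pre_digraph \<Rightarrow> 'a set \<Rightarrow> 'a set" where
  "closed_nbhd_set G S = (\<Union>v\<in>S. closed_nbhd G v)"

definition force_step :: "'a pair_pre_digraph \<Rightarrow> 'a set \<Rightarrow> 'a set \<Rightarrow> bool" where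
  "force_step G A B \<longleftrightarrow> (\<exists>u\<in>A. \<exists>w. nbhd G u - A = {w} \<and> B = insert w A)"

definition closure_result :: "'a pair_pre_digraph \<Rightarrow> 'a set \<Rightarrow> 'a set \<Rightarrow> bool" where
  "closure_result G U C \<longleftrightarrow> (force_step G)\<^sup>*\<^sup>* U C \<and> (\<nexists>D. force_step G C D)"

text \<open>For a finite graph the result exists and does not depend on the order of the steps,
  see \<open>closure_result_ex1\<close> below.\<close>

definition cl :: "'a pair_pre_digraph \<Rightarrow> 'a set \<Rightarrow> 'a set" where
  "cl G U = (THE C. closure_result G U C)"

definition power_dominating :: "'a pair_pre_digraph \<Rightarrow> 'a set \<Rightarrow> bool" where
  "power_dominating G S \<longleftrightarrow> S \<subseteq> pverts G \<and> cl G (closed_nbhd_set G S) = pverts G"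

definition power_domination_number :: "'a pair_pre_digraph \<Rightarrow> nat" (\<open>\<gamma>\<^sub>p\<close>) where
  "\<gamma>\<^sub>p G = Min (card ` {S. power_dominating G S})"

definition cycle_graph :: "nat \<Rightarrow> nat pair_pre_digraph" where
  "cycle_graph n = \<lparr> pverts = {..<n},
     parcs = {(i, j). i < n \<and> j < n \<and> (j = (i + 1) mod n \<or> i = (j + 1) mod n)} \<rparr>"

text \<open>\<open>Orig v\<^sub>i\<close>, \<open>Copy v\<^sub>i\<close> and \<open>Apex\<close> stand for \<open>v\<^sub>i\<close>, \<open>u\<^sub>i\<close> and \<open>w\<close>, respectively.\<close>

datatype 'a myc_vertex = Orig 'a | Copy 'a | Apex

definition mycielskian :: "'a pair_pre_digraph \<Rightarrow> 'a myc_vertex pair_pre_digraph" where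
  "mycielskian G = \<lparr>
     pverts = Orig ` pverts G \<union> Copy ` pverts G \<union> {Apex},
     parcs = {(Orig a, Orig b) |a b. (a, b) \<in> parcs G}
       \<union> {(Copy a, Orig b) |a b. (a, b) \<in> parcs G}
       \<union> {(Orig b, Copy a) |a b. (a, b) \<in> parcs G}
       \<union> {(Copy a, Apex) |a. a \<in> pverts G}
       \<union> {(Apex, Copy a) |a. a \<in> pverts G} \<rparr>"

lemma pair_graph_cycle_graph:
  assumes "n \<ge> 3"
  shows "pair_graph (cycle_graph n)"
proof
  show "finite (parcs (cycle_graph n))"
    by (rule finite_subset[of _ "{..<n} \<times> {..<n}"]) (auto simp: cycle_graph_def)
next
  fix e assume "e \<in> parcs (cycle_graph n)"
  then show "fst e \<noteq> snd e"
    using assms by (auto simp: cycle_graph_def mod_Suc split: if_splits)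
qed (auto simp: cycle_graph_def symmetric_def sym_def)

lemma pair_graph_mycielskian:
  assumes "pair_graph G"
  shows "pair_graph (mycielskian G)"
proof -
  interpret pair_graph G by fact
  have sym: "(b, a) \<in> parcs G" if "(a, b) \<in> parcs G" for a b
    using pair_sym_arcs that by (auto simp: symmetric_def sym_def)
  have wf: "fst e \<in> pverts (mycielskian G) \<and> snd e \<in> pverts (mycielskian G)"
    if "e \<in> parcs (mycielskian G)" for e
    using that by (auto simp: mycielskian_def dest: in_arcsD1 in_arcsD2)
  have fin: "finite (pverts (mycielskian G))"
    by (auto simp: mycielskian_def)
  show ?thesis
  proof
    show "finite (parcs (mycielskian G))"
      by (rule finite_subset[of _ "pverts (mycielskian G) \<times> pverts (mycielskian G)"])
        (use wf fin in force)+
  next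
    fix e assume "e \<in> parcs (mycielskian G)"
    then show "fst e \<noteq> snd e"
      by (auto simp: mycielskian_def dest: no_loops')
  next
    show "symmetric (mycielskian G)"
      by (auto simp: mycielskian_def symmetric_def sym_def dest: sym)
  qed (use wf fin in auto)
qed

lemma closure_result_least:
  assumes "(force_step G)\<^sup>*\<^sup>* U C" "U \<subseteq> D" "\<nexists>D'. force_step G D D'"
  shows "C \<subseteq> D"
  using assms(1)
proof (induction rule: rtranclp_induct)
  case base
  show ?case by (fact assms(2))
next
  case (step A B)
  then obtain u w where uw: "u \<in> A" "nbhd G u - A = {w}" "B = insert w A"
    by (auto simp: force_step_def)
  have "w \<in> D"
  proof (rule ccontr)
    assume "w \<notin> D"
    with uw step.IH have "nbhd G u - D = {w}" "u \<in> D" by blast+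
    then have "force_step G D (insert w D)" by (auto simp: force_step_def)
    with assms(3) show False by blast
  qed
  with uw step.IH show ?case by blast
qed

lemma closure_result_unique:
  assumes "closure_result G U C" "closure_result G U D"
  shows "C = D"
proof -
  have ext: "U \<subseteq> A" if "(force_step G)\<^sup>*\<^sup>* U A" for A
    using that by induction (auto simp: force_step_def)
  show ?thesis
    using assms closure_result_least[of G U C D] closure_result_least[of G U D C]
    by (auto simp: closure_result_def dest!: ext)
qed

lemma closure_result_ex1:
  assumes "pair_fin_digraph G"
  shows "\<exists>!C. closure_result G U C"
proof -
  interpret pair_fin_digraph G by fact
  have "\<exists>C. closure_result G U C"
  proof (induction "card (pverts G - U)" arbitrary: U rule: less_induct)
    case less
    show ?case
    proof (cases "\<exists>D. force_step G U D")
      case True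
      then obtain u w where uw: "nbhd G u - U = {w}" "force_step G U (insert w U)"
        by (auto simp: force_step_def)
      then have "w \<in> pverts G - U"
        by (auto simp: nbhd_def dest: in_arcsD2)
      then have "card (pverts G - insert w U) < card (pverts G - U)"
        by (intro psubset_card_mono) auto
      from less[OF this] obtain C where "closure_result G (insert w U) C" by blast
      with uw have "closure_result G U C"
        unfolding closure_result_def by (blast intro: converse_rtranclp_into_rtranclp)
      then show ?thesis by blast
    qed (auto simp: closure_result_def)
  qed
  then show ?thesis
    using closure_result_unique by blast
qed

lemma closure_result_cl:
  assumes "pair_fin_digraph G"
  shows "closure_result G U (cl G U)"
  unfolding cl_def by (rule theI') (rule closure_result_ex1[OF assms])

lemma power_dominating_pverts:
  assumes "pair_fin_digraph G"
  shows "power_dominating G (pverts G)"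
proof -
  interpret pair_fin_digraph G by fact
  have "closed_nbhd_set G (pverts G) = pverts G"
    by (auto simp: closed_nbhd_set_def closed_nbhd_def nbhd_def dest: in_arcsD2)
  moreover have "\<not> force_step G (pverts G) D" for D
    by (auto simp: force_step_def nbhd_def dest: in_arcsD2)
  then have "closure_result G (pverts G) (pverts G)"
    by (simp add: closure_result_def)
  then have "cl G (pverts G) = pverts G"
    using closure_result_unique closure_result_cl[OF assms] by blast
  ultimately show ?thesis
    by (simp add: power_dominating_def)
qed

end

theory Submission
  imports Defs
begin

text \<open>
  Everything rests on one reformulation: \<open>S\<close> is power dominating iff every superset of \<open>N[S]\<close>
  that admits no forcing step contains all vertices (\<open>power_dominating_iff\<close>). So closures need
  not be computed: a superset of \<open>N[S]\<close> that misses a vertex and admits no forcing step refutes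
  power domination, and power domination is proved by following forces inside an arbitrary such superset.

  Upper bounds. Once the apex is chosen, all copies are dominated, and forcing among the original
  vertices proceeds exactly as in \<open>G\<close>; hence adding the apex to a power dominating set of \<open>G\<close> gives
  one of the Mycielskian. In a cycle a single vertex suffices, because each end of an
  observed arc forces the next vertex. In \<open>C\<^sub>3\<close> the apex can be saved: a single original
  vertex dominates all original vertices, which leaves only its own copy and the apex to be forced.

  Lower bound for \<open>n \<ge> 4\<close>. For each vertex \<open>x\<close> of the Mycielskian, \<open>N[x]\<close> is already
  without forcing steps: every vertex of \<open>N[x]\<close> with an unobserved neighbour has at least two.
  This uses only that \<open>G\<close> has no isolated vertices and that the end \<open>j\<close> of any edge
  \<open>ij\<close> of \<open>G\<close> has a neighbour outside \<open>N[i]\<close>, which holds in all cycles except the triangle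
  (\<open>not_power_dominating_mycielskian\<close>).
\<close>

section \<open>Power domination without computing closures\<close>

definition stalled :: "'a pair_pre_digraph \<Rightarrow> 'a set \<Rightarrow> bool" where
  "stalled G C \<longleftrightarrow> (\<forall>u\<in>C. \<forall>w. nbhd G u - C \<noteq> {w})"

lemma stalled_iff_no_force_step: "stalled G C \<longleftrightarrow> (\<nexists>D. force_step G C D)"
  by (auto simp: stalled_def force_step_def)

lemma stalledI:
  assumes "\<And>u. u \<in> C \<Longrightarrow> nbhd G u \<subseteq> C \<or> (\<exists>x\<in>nbhd G u - C. \<exists>y\<in>nbhd G u - C. x \<noteq> y)"
  shows "stalled G C"
  unfolding stalled_def
proof (intro ballI allI notI)
  fix u w assume "u \<in> C" "nbhd G u - C = {w}"
  with assms[of u] show False by auto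
qed

lemma stalledD:
  assumes "stalled G C" "u \<in> C" "nbhd G u \<subseteq> insert w C"
  shows "nbhd G u \<subseteq> C"
  using assms by (auto simp: stalled_def)

lemma subset_cl:
  assumes "pair_fin_digraph G"
  shows "U \<subseteq> cl G U"
proof -
  have "(force_step G)\<^sup>*\<^sup>* U (cl G U)"
    using closure_result_cl[OF assms] by (auto simp: closure_result_def)
  then show ?thesis
    by induction (auto simp: force_step_def)
qed

lemma stalled_cl: "pair_fin_digraph G \<Longrightarrow> stalled G (cl G U)"
  using closure_result_cl[of G U] by (simp add: closure_result_def stalled_iff_no_force_step)

lemma cl_least:
  assumes "pair_fin_digraph G" "U \<subseteq> C" "stalled G C"
  shows "cl G U \<subseteq> C"
  using closure_result_least[of G U "cl G U" C] closure_result_cl[OF assms(1)] assms(2,3)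
  by (auto simp: closure_result_def stalled_iff_no_force_step)

text \<open>
  The closure is the least superset that admits no forcing step. It stays inside the vertex set
  because the vertex set itself is such a superset.
\<close>

lemma power_dominating_iff:
  assumes "pair_fin_digraph G"
  shows "power_dominating G S \<longleftrightarrow>
    S \<subseteq> pverts G \<and> (\<forall>C. closed_nbhd_set G S \<subseteq> C \<longrightarrow> stalled G C \<longrightarrow> pverts G \<subseteq> C)"
proof (cases "S \<subseteq> pverts G")
  case True
  interpret pair_fin_digraph G by fact
  have "stalled G (pverts G)"
    by (rule stalledI) (auto simp: nbhd_def dest: in_arcsD2)
  moreover have "closed_nbhd_set G S \<subseteq> pverts G"
    using True by (auto simp: closed_nbhd_set_def closed_nbhd_def nbhd_def dest: in_arcsD2)
  ultimately have "cl G (closed_nbhd_set G S) \<subseteq> pverts G"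
    using cl_least[OF assms] by blast
  then have "power_dominating G S \<longleftrightarrow> pverts G \<subseteq> cl G (closed_nbhd_set G S)"
    using True by (auto simp: power_dominating_def)
  also have "\<dots> \<longleftrightarrow> (\<forall>C. closed_nbhd_set G S \<subseteq> C \<longrightarrow> stalled G C \<longrightarrow> pverts G \<subseteq> C)"
    using subset_cl[OF assms] stalled_cl[OF assms] cl_least[OF assms] by (meson order_trans)
  finally show ?thesis using True by simp
qed (simp add: power_dominating_def)

lemma not_power_dominating_empty:
  assumes "pair_fin_digraph G" "pverts G \<noteq> {}"
  shows "\<not> power_dominating G {}"
  using assms by (auto simp: power_dominating_iff closed_nbhd_set_def stalled_def)

lemma power_domination_number_eqI:
  assumes "pair_fin_digraph G" "power_dominating G S" "card S = k"
    and "\<And>T. finite T \<Longrightarrow> power_dominating G T \<Longrightarrow> k \<le> card T"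
  shows "\<gamma>\<^sub>p G = k"
proof -
  interpret pair_fin_digraph G by fact
  have sub: "{T. power_dominating G T} \<subseteq> Pow (pverts G)"
    by (auto simp: power_dominating_def)
  then have "finite {T. power_dominating G T}"
    by (rule finite_subset) simp
  moreover have "finite T" if "power_dominating G T" for T
    using that sub finite_subset[of T "pverts G"] by auto
  ultimately show ?thesis
    unfolding power_domination_number_def using assms(2-4) by (intro Min_eqI) auto
qed

section \<open>Mycielskian graphs\<close>

lemma pverts_mycielskian: "pverts (mycielskian G) = Orig ` pverts G \<union> Copy ` pverts G \<union> {Apex}"
  by (simp add: mycielskian_def)

lemma nbhd_mycielskian_Orig:
  assumes "pair_graph G"
  shows "nbhd (mycielskian G) (Orig a) = Orig ` nbhd G a \<union> Copy ` nbhd G a"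
proof -
  interpret pair_graph G by fact
  have "(x, y) \<in> parcs G \<longleftrightarrow> (y, x) \<in> parcs G" for x y
    using pair_sym_arcs by (auto simp: symmetric_def sym_def)
  then show ?thesis
    by (auto simp: nbhd_def mycielskian_def)
qed

lemma nbhd_mycielskian_Copy:
  "a \<in> pverts G \<Longrightarrow> nbhd (mycielskian G) (Copy a) = insert Apex (Orig ` nbhd G a)"
  by (auto simp: nbhd_def mycielskian_def)

lemma nbhd_mycielskian_Apex: "nbhd (mycielskian G) Apex = Copy ` pverts G"
  by (auto simp: nbhd_def mycielskian_def)

text \<open>
  The apex dominates every copy. With all copies observed, an original vertex of the Mycielskian
  has the same unobserved neighbours as the corresponding vertex of \<open>G\<close>.
\<close>

lemma power_dominating_mycielskian:
  assumes G: "pair_graph G" and S: "power_dominating G S"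
  shows "power_dominating (mycielskian G) (insert Apex (Orig ` S))"
proof -
  interpret pair_graph G by fact
  interpret M: pair_graph "mycielskian G" by (rule pair_graph_mycielskian[OF G])
  have S': "S \<subseteq> pverts G"
    and dom: "\<And>C. closed_nbhd_set G S \<subseteq> C \<Longrightarrow> stalled G C \<Longrightarrow> pverts G \<subseteq> C"
    using S by (auto simp: power_dominating_iff[OF pair_fin_digraph_axioms])
  have "pverts (mycielskian G) \<subseteq> C"
    if N: "closed_nbhd_set (mycielskian G) (insert Apex (Orig ` S)) \<subseteq> C"
      and st: "stalled (mycielskian G) C" for C
  proof -
    have apex: "Apex \<in> C" and copies: "Copy ` pverts G \<subseteq> C"
      and orig: "\<And>a. a \<in> S \<Longrightarrow> Orig a \<in> C \<and> Orig ` nbhd G a \<subseteq> C"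
      using N by (simp_all add: closed_nbhd_set_def closed_nbhd_def nbhd_mycielskian_Orig[OF G]
          nbhd_mycielskian_Apex UN_subset_iff)
    let ?O = "{a. Orig a \<in> C}"
    have "closed_nbhd_set G S \<subseteq> ?O"
      using orig by (auto simp: closed_nbhd_set_def closed_nbhd_def)
    moreover have "stalled G ?O"
      unfolding stalled_def
    proof (intro ballI allI notI)
      fix u w assume u: "u \<in> ?O" and w: "nbhd G u - ?O = {w}"
      have "nbhd G u \<subseteq> pverts G"
        by (auto simp: nbhd_def dest: in_arcsD2)
      with copies w have "nbhd (mycielskian G) (Orig u) - C = {Orig w}"
        by (auto simp: nbhd_mycielskian_Orig[OF G])
      with st u show False by (auto simp: stalled_def)
    qed
    ultimately have "pverts G \<subseteq> ?O" by (rule dom)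
    with apex copies show ?thesis by (auto simp: pverts_mycielskian)
  qed
  then show ?thesis
    using S' by (auto simp: power_dominating_iff[OF M.pair_fin_digraph_axioms] pverts_mycielskian)
qed

text \<open>
  The last hypothesis supplies the second unobserved neighbour at every vertex that could
  otherwise force. In the neighbourhood of \<open>Orig i\<close>, the vertices \<open>Orig j\<close> and \<open>Copy j\<close> see, for a
  neighbour \<open>k\<close> of \<open>j\<close> outside \<open>N[i]\<close>, the pairs \<open>Copy i, Copy k\<close> and \<open>Apex, Orig k\<close>. In
  that of \<open>Copy i\<close>, each \<open>Orig j\<close> sees \<open>Orig i, Copy k\<close>. Read at the edge \<open>ji\<close>, the
  hypothesis also says that \<open>i\<close> has two neighbours, which settles the remaining cases.
\<close>

lemma not_power_dominating_mycielskian: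
  assumes G: "pair_graph G"
    and no_isolated: "\<And>i. i \<in> pverts G \<Longrightarrow> nbhd G i \<noteq> {}"
    and nonempty: "pverts G \<noteq> {}"
    and outside: "\<And>i j. j \<in> nbhd G i \<Longrightarrow> \<not> nbhd G j \<subseteq> closed_nbhd G i"
  shows "\<not> power_dominating (mycielskian G) {x}"
proof
  let ?M = "mycielskian G"
  interpret pair_graph G by fact
  interpret M: pair_graph ?M by (rule pair_graph_mycielskian[OF G])
  have sym: "i \<in> nbhd G j" if "j \<in> nbhd G i" for i j
    using that pair_sym_arcs by (auto simp: nbhd_def symmetric_def sym_def)
  have irrefl: "i \<notin> nbhd G i" for i
    by (auto simp: nbhd_def dest: no_loops')
  have verts: "j \<in> pverts G" if "j \<in> nbhd G i" for i j
    using that by (auto simp: nbhd_def dest: in_arcsD2)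
  have two: "\<exists>j\<in>nbhd G i. \<exists>k\<in>nbhd G i. j \<noteq> k" if i: "i \<in> pverts G" for i
  proof -
    obtain j where j: "j \<in> nbhd G i" using no_isolated[OF i] by blast
    with outside[OF sym[OF j]] show ?thesis by (auto simp: closed_nbhd_def)
  qed
  assume pd: "power_dominating ?M {x}"
  then have x: "x \<in> pverts ?M" by (simp add: power_dominating_def)
  have "stalled ?M (closed_nbhd ?M x) \<and> \<not> pverts ?M \<subseteq> closed_nbhd ?M x"
  proof (cases x)
    case (Orig i)
    then have N: "closed_nbhd ?M x = insert (Orig i) (Orig ` nbhd G i \<union> Copy ` nbhd G i)"
      by (simp add: closed_nbhd_def nbhd_mycielskian_Orig[OF G])
    have i: "i \<in> pverts G" using x Orig by (auto simp: pverts_mycielskian)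
    have "stalled ?M (closed_nbhd ?M x)"
    proof (rule stalledI)
      fix u assume "u \<in> closed_nbhd ?M x"
      then consider "u = Orig i" | j where "u = Orig j" "j \<in> nbhd G i"
        | j where "u = Copy j" "j \<in> nbhd G i"
        unfolding N by blast
      then show "nbhd ?M u \<subseteq> closed_nbhd ?M x \<or>
        (\<exists>y\<in>nbhd ?M u - closed_nbhd ?M x. \<exists>z\<in>nbhd ?M u - closed_nbhd ?M x. y \<noteq> z)"
      proof cases
        case 1
        then show ?thesis unfolding N by (auto simp: nbhd_mycielskian_Orig[OF G])
      next
        case (2 j)
        obtain k where k: "k \<in> nbhd G j" "k \<noteq> i" "k \<notin> nbhd G i"
          using outside[OF 2(2)] by (auto simp: closed_nbhd_def)
        have "Copy i \<in> nbhd ?M u - closed_nbhd ?M x" "Copy k \<in> nbhd ?M u - closed_nbhd ?M x"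
          using 2 k sym irrefl unfolding N by (auto simp: nbhd_mycielskian_Orig[OF G])
        with k show ?thesis by blast
      next
        case (3 j)
        obtain k where k: "k \<in> nbhd G j" "k \<noteq> i" "k \<notin> nbhd G i"
          using outside[OF 3(2)] by (auto simp: closed_nbhd_def)
        have "Apex \<in> nbhd ?M u - closed_nbhd ?M x" "Orig k \<in> nbhd ?M u - closed_nbhd ?M x"
          using 3 k verts unfolding N by (auto simp: nbhd_mycielskian_Copy)
        then show ?thesis by blast
      qed
    qed
    moreover have "Copy i \<in> pverts ?M - closed_nbhd ?M x"
      using i irrefl unfolding N by (auto simp: pverts_mycielskian)
    ultimately show ?thesis by blast
  next
    case (Copy i)
    have i: "i \<in> pverts G" using x Copy by (auto simp: pverts_mycielskian)
    have N: "closed_nbhd ?M x = {Copy i, Apex} \<union> Orig ` nbhd G i"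
      using Copy i by (auto simp: closed_nbhd_def nbhd_mycielskian_Copy)
    have "stalled ?M (closed_nbhd ?M x)"
    proof (rule stalledI)
      fix u assume "u \<in> closed_nbhd ?M x"
      then consider "u = Copy i" | "u = Apex" | j where "u = Orig j" "j \<in> nbhd G i"
        unfolding N by blast
      then show "nbhd ?M u \<subseteq> closed_nbhd ?M x \<or>
        (\<exists>y\<in>nbhd ?M u - closed_nbhd ?M x. \<exists>z\<in>nbhd ?M u - closed_nbhd ?M x. y \<noteq> z)"
      proof cases
        case 1
        then show ?thesis unfolding N by (auto simp: nbhd_mycielskian_Copy[OF i])
      next
        case 2
        obtain j k where jk: "j \<in> nbhd G i" "k \<in> nbhd G i" "j \<noteq> k" using two[OF i] by blast
        then have "j \<noteq> i" "k \<noteq> i" using irrefl by auto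
        then have "Copy j \<in> nbhd ?M u - closed_nbhd ?M x" "Copy k \<in> nbhd ?M u - closed_nbhd ?M x"
          using 2 jk verts unfolding N by (auto simp: nbhd_mycielskian_Apex)
        with jk show ?thesis by blast
      next
        case (3 j)
        obtain k where k: "k \<in> nbhd G j" "k \<noteq> i"
          using outside[OF 3(2)] by (auto simp: closed_nbhd_def)
        have "Orig i \<in> nbhd ?M u - closed_nbhd ?M x" "Copy k \<in> nbhd ?M u - closed_nbhd ?M x"
          using 3 k sym irrefl unfolding N by (auto simp: nbhd_mycielskian_Orig[OF G])
        then show ?thesis by blast
      qed
    qed
    moreover have "Orig i \<in> pverts ?M - closed_nbhd ?M x"
      using i irrefl unfolding N by (auto simp: pverts_mycielskian)
    ultimately show ?thesis by blast
  next
    case Apex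
    then have N: "closed_nbhd ?M x = insert Apex (Copy ` pverts G)"
      by (simp add: closed_nbhd_def nbhd_mycielskian_Apex)
    have "stalled ?M (closed_nbhd ?M x)"
    proof (rule stalledI)
      fix u assume "u \<in> closed_nbhd ?M x"
      then consider "u = Apex" | i where "u = Copy i" "i \<in> pverts G"
        unfolding N by blast
      then show "nbhd ?M u \<subseteq> closed_nbhd ?M x \<or>
        (\<exists>y\<in>nbhd ?M u - closed_nbhd ?M x. \<exists>z\<in>nbhd ?M u - closed_nbhd ?M x. y \<noteq> z)"
      proof cases
        case 1
        then show ?thesis unfolding N by (auto simp: nbhd_mycielskian_Apex)
      next
        case (2 i)
        obtain j k where jk: "j \<in> nbhd G i" "k \<in> nbhd G i" "j \<noteq> k" using two[OF 2(2)] by blast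
        then have "Orig j \<in> nbhd ?M u - closed_nbhd ?M x" "Orig k \<in> nbhd ?M u - closed_nbhd ?M x"
          using 2 unfolding N by (auto simp: nbhd_mycielskian_Copy)
        with jk show ?thesis by blast
      qed
    qed
    moreover have "\<not> pverts ?M \<subseteq> closed_nbhd ?M x"
      using nonempty unfolding N by (auto simp: pverts_mycielskian)
    ultimately show ?thesis by blast
  qed
  with pd show False
    by (auto simp: power_dominating_iff[OF M.pair_fin_digraph_axioms] closed_nbhd_set_def)
qed

section \<open>Cycles\<close>

lemma pverts_cycle_graph: "pverts (cycle_graph n) = {..<n}"
  by (simp add: cycle_graph_def)

lemma nbhd_cycle_graph:
  assumes "n \<ge> 3" "i < n"
  shows "nbhd (cycle_graph n) i =
    {if Suc i = n then 0 else Suc i, if i = 0 then n - 1 else i - 1}"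
  using assms by (auto simp: nbhd_def cycle_graph_def mod_Suc split: if_splits)

lemma power_dominating_cycle_graph:
  assumes n: "n \<ge> 3"
  shows "power_dominating (cycle_graph n) {0}"
proof -
  let ?G = "cycle_graph n"
  interpret pair_graph ?G by (rule pair_graph_cycle_graph[OF n])
  have "pverts ?G \<subseteq> C" if N: "closed_nbhd_set ?G {0} \<subseteq> C" and st: "stalled ?G C" for C
  proof -
    have "{0, 1} \<subseteq> C"
      using N n by (auto simp: closed_nbhd_set_def closed_nbhd_def nbhd_cycle_graph)
    \<comment> \<open>Forcing the next vertex needs two consecutive observed ones.\<close>
    have "Suc i < n \<Longrightarrow> i \<in> C \<and> Suc i \<in> C" for i
    proof (induction i)
      case 0
      then show ?case using \<open>{0, 1} \<subseteq> C\<close> by simp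
    next
      case (Suc i)
      then have "nbhd ?G (Suc i) = {i, Suc (Suc i)}"
        using n by (auto simp: nbhd_cycle_graph)
      with Suc stalledD[OF st, of "Suc i" "Suc (Suc i)"] show ?case by simp
    qed
    then have "i \<in> C" if "i < n" for i
      using that \<open>{0, 1} \<subseteq> C\<close> by (cases i) auto
    then show ?thesis by (auto simp: pverts_cycle_graph)
  qed
  then show ?thesis
    using n by (auto simp: power_dominating_iff[OF pair_fin_digraph_axioms] pverts_cycle_graph)
qed

text \<open>
  In the triangle, \<open>Orig 0\<close> dominates everything except \<open>Copy 0\<close> and \<open>Apex\<close>; the former is
  forced by \<open>Orig 1\<close>, the latter by \<open>Copy 1\<close>.
\<close>

lemma power_dominating_mycielskian_triangle:
  "power_dominating (mycielskian (cycle_graph 3)) {Orig 0}"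
proof -
  let ?G = "cycle_graph 3" and ?M = "mycielskian (cycle_graph 3)"
  have G: "pair_graph ?G" by (rule pair_graph_cycle_graph) simp
  interpret M: pair_graph ?M by (rule pair_graph_mycielskian[OF G])
  have nb: "nbhd ?G 0 = {1, 2}" "nbhd ?G (Suc 0) = {0, 2}"
    by (auto simp: nbhd_cycle_graph)
  have verts: "{..<3} = {0, 1, 2::nat}" by auto
  have "pverts ?M \<subseteq> C" if N: "closed_nbhd_set ?M {Orig 0} \<subseteq> C" and st: "stalled ?M C" for C
  proof -
    have obs: "{Orig 0, Orig 1, Orig 2, Copy 1, Copy 2} \<subseteq> C"
      using N by (auto simp: closed_nbhd_set_def closed_nbhd_def nbhd_mycielskian_Orig[OF G] nb)
    have "Copy 0 \<in> C"
      using stalledD[OF st, of "Orig 1" "Copy 0"] obs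
      by (auto simp: nbhd_mycielskian_Orig[OF G] nb)
    moreover have "Apex \<in> C"
      using stalledD[OF st, of "Copy 1" Apex] obs
      by (auto simp: nbhd_mycielskian_Copy pverts_cycle_graph nb)
    ultimately show ?thesis
      using obs by (auto simp: pverts_mycielskian pverts_cycle_graph verts)
  qed
  then show ?thesis
    by (auto simp: power_dominating_iff[OF M.pair_fin_digraph_axioms] pverts_mycielskian
        pverts_cycle_graph)
qed

lemma cycle_graph_nbhd_outside:
  assumes n: "n \<ge> 4" and j: "j \<in> nbhd (cycle_graph n) i"
  shows "\<not> nbhd (cycle_graph n) j \<subseteq> closed_nbhd (cycle_graph n) i"
proof -
  have lt: "i < n" "j < n" using j by (auto simp: nbhd_def cycle_graph_def)
  with n j show ?thesis
    by (auto simp: nbhd_cycle_graph closed_nbhd_def split: if_splits)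
qed

theorem theorem24:
  fixes n :: nat
  assumes "n \<ge> 3"
  shows "(n = 3 \<longrightarrow> \<gamma>\<^sub>p (mycielskian (cycle_graph n)) = 1) \<and>
         (n \<ge> 4 \<longrightarrow> \<gamma>\<^sub>p (mycielskian (cycle_graph n)) = 2)"
proof -
  let ?G = "cycle_graph n" and ?M = "mycielskian (cycle_graph n)"
  have G: "pair_graph ?G" by (rule pair_graph_cycle_graph[OF assms])
  interpret M: pair_graph ?M by (rule pair_graph_mycielskian[OF G])
  note fin = M.pair_fin_digraph_axioms
  have "\<not> power_dominating ?M {}"
    by (rule not_power_dominating_empty[OF fin]) (simp add: pverts_mycielskian)
  then have pos: "1 \<le> card T" if "finite T" "power_dominating ?M T" for T
    using that by (cases "T = {}") (auto simp: Suc_le_eq card_gt_0_iff)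
  have "\<gamma>\<^sub>p ?M = 1" if "n = 3"
    using power_dominating_mycielskian_triangle that pos
    by (intro power_domination_number_eqI[OF fin, of "{Orig 0}"]) auto
  moreover have "\<gamma>\<^sub>p ?M = 2" if n: "n \<ge> 4"
  proof (rule power_domination_number_eqI[OF fin])
    show "power_dominating ?M {Apex, Orig 0}"
      using power_dominating_mycielskian[OF G power_dominating_cycle_graph[OF assms]] by simp
  next
    fix T assume T: "finite T" "power_dominating ?M T"
    have "\<not> power_dominating ?M {x}" for x
      using assms by (intro not_power_dominating_mycielskian[OF G] cycle_graph_nbhd_outside[OF n])
        (auto simp: pverts_cycle_graph nbhd_cycle_graph lessThan_empty_iff)
    with T have "card T \<noteq> 1" by (auto simp: card_1_singleton_iff)
    with pos[OF T] show "2 \<le> card T" by simp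
  qed simp
  ultimately show ?thesis by blast
qed

end
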